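(* Let $q$ be a prime power, and let $n,t,r,k_1,k,u$ be integers with $t,r\ge0$, $k_1=n-1-r$, $k=k_1+1$ and $q\le u\le k_1$. Let $$\boldsymbol{G}=\begin{bmatrix}\boldsymbol{G}_1\\ \boldsymbol{G}_0\end{bmatrix}=\begin{bmatrix}\boldsymbol{0}_{k_1\times 1} & \boldsymbol{I}_{k_1} & \boldsymbol{P}_{k_1\times r}\\ 1 & \boldsymbol{1}_{1\times k_1} & \boldsymbol{1}_{1\times r}\end{bmatrix}\in\mathbb{F}_q^{k\times n},\qquad \boldsymbol{P}\in\mathbb{F}_q^{k_1\times r},$$ be a generator matrix of an $[n,k,d]_q$ code with $d\ge 2t+1$. Let $\phi_1,\dots,\phi_u$ be positions of cells partially stuck at level $1$ such that the columns of $\boldsymbol{G}$ indexed by $\phi_1,\dots,\phi_u$ are linearly independent. For a message $\boldsymbol{m}\in\mathbb{F}_q^{k_1}$ drawn uniformly at random, the probability that the word can be masked, i.e. that there exists $z_0\in\mathbb{F}_q$ such that $\boldsymbol{c}=\boldsymbol{m}\boldsymbol{G}_1+z_0\boldsymbol{G}_0$ satisfies $c_{\phi_i}\neq 0$ for all $i=1,\dots,u$, equals $$\mathrm{P}(q,u)=\frac{\sum_{i=1}^{q}(-1)^{i+1}\binom{q}{i}(q-i)^u}{q^u}.$$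
   Context: $\mathbb{F}_q$ is the finite field with $q$ elements; its elements are identified with the memory levels $0,1,\dots,q-1$, with the field's zero element corresponding to level $0$. An $[n,k,d]_q$ code is a linear code over $\mathbb{F}_q$ of length $n$, dimension $k$ and minimum Hamming distance $d$. $\boldsymbol{0}_{a\times b}$, $\boldsymbol{1}_{a\times b}$ are all-zero and all-one matrices, and $\boldsymbol{I}_a$ is the identity matrix. A cell partially stuck at level $1$ can store only values at least $1$, i.e. exactly the nonzero elements of $\mathbb{F}_q$. Masking a message $\boldsymbol{m}$ means: with $\boldsymbol{w}=\boldsymbol{m}\boldsymbol{G}_1$, find $v\in\mathbb{F}_q$ with $w_{\phi_i}\ne v$ for all $i$, and store $\boldsymbol{c}=\boldsymbol{w}+z_0\boldsymbol{G}_0$ with $z_0=-v$, so that $c_{\phi_i}\ne 0$ at all partially stuck positions. *)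

theory Defs
  imports "HOL-Probability.Probability_Mass_Function" "Jordan_Normal_Form.VS_Connect"
begin

unbundle no vec_syntax

definition hamming_dist :: "'a vec \<Rightarrow> 'a vec \<Rightarrow> nat" where
  "hamming_dist x y = card {i. i < dim_vec x \<and> x $ i \<noteq> y $ i}"

text \<open>Only meaningful for a finite code with at least two codewords.\<close>
definition min_dist :: "'a vec set \<Rightarrow> nat" where
  "min_dist C = Min {hamming_dist x y | x y. x \<in> C \<and> y \<in> C \<and> x \<noteq> y}"

text \<open>\<open>C\<close> is an \<open>[n, k, d]\<close> code over the finite field \<open>'a\<close>.\<close>
definition linear_code :: "nat \<Rightarrow> nat \<Rightarrow> nat \<Rightarrow> ('a :: {field, finite}) vec set \<Rightarrow> bool" where
  "linear_code n k d C \<longleftrightarrow>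
     VectorSpace.subspace class_ring C (module_vec TYPE('a) n) \<and>
     vectorspace.dim class_ring (module_vec TYPE('a) n \<lparr>carrier := C\<rparr>) = k \<and>
     min_dist C = d"

definition generator_matrix :: "nat \<Rightarrow> nat \<Rightarrow> ('a :: field) vec set \<Rightarrow> 'a mat \<Rightarrow> bool" where
  "generator_matrix n k C G \<longleftrightarrow>
     G \<in> carrier_mat k n \<and> distinct (rows G) \<and>
     vectorspace.basis class_ring (module_vec TYPE('a) n \<lparr>carrier := C\<rparr>) (set (rows G))"

text \<open>Linear independence of a family; the injectivity clause excludes repeated vectors,
  which the set-based predicate \<open>lin_dep\<close> cannot see.\<close>
definition lin_indpt_family :: "nat \<Rightarrow> 'i set \<Rightarrow> ('i \<Rightarrow> ('a :: field) vec) \<Rightarrow> bool" where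
  "lin_indpt_family k I f \<longleftrightarrow>
     inj_on f I \<and> \<not> LinearCombinations.module.lin_dep class_ring (module_vec TYPE('a) k) (f ` I)"

text \<open>Columns \<open>A | B\<close> side by side, analogous to \<^const>\<open>append_rows\<close>.\<close>
definition append_cols :: "('a :: zero) mat \<Rightarrow> 'a mat \<Rightarrow> 'a mat" (infixr "@\<^sub>c" 70) where
  "A @\<^sub>c B = four_block_mat A B (0\<^sub>m 0 (dim_col A)) (0\<^sub>m 0 (dim_col B))"

definition ones_mat :: "nat \<Rightarrow> nat \<Rightarrow> ('a :: one) mat" where
  "ones_mat a b = mat a b (\<lambda>_. 1)"

text \<open>A cell that is partially stuck at level 1 stores exactly the nonzero field elements,
  the zero element being level 0. The word is masked by adding a multiple of the (single) row
  of \<open>G0\<close>; words are row vectors, represented as one-row matrices.\<close>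
definition maskable :: "('a :: field) mat \<Rightarrow> 'a mat \<Rightarrow> nat set \<Rightarrow> 'a vec \<Rightarrow> bool" where
  "maskable G1 G0 \<Phi> m \<longleftrightarrow>
     (\<exists>z0. \<forall>j\<in>\<Phi>. (mat_of_row m * G1 + z0 \<cdot>\<^sub>m G0) $$ (0, j) \<noteq> 0)"

end

theory Submission
  imports Defs "Berlekamp_Zassenhaus.Berlekamp_Type_Based"
begin

text \<open>
  Since \<open>G0\<close> is the all-one row, masking succeeds iff the stored entries of \<open>m G1\<close> miss some
  field element. This is unaffected by adding a constant to all entries, so \<open>m\<close> may be replaced by
  a uniform pair \<open>(m, z)\<close> with word \<open>m G1 + z G0\<close>. The map from \<open>(m, z)\<close> to the \<open>u\<close> selected entries
  is linear and, the columns of \<open>G\<close> being independent, onto; hence all its fibres have the same size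
  and the entries are uniform on all \<open>u\<close>-tuples. Inclusion-exclusion over the set of missed elements
  counts the tuples that miss an element. (Without \<open>z\<close> this fails: the columns of \<open>G1\<close> alone may be
  dependent, e.g. its first column is zero.)
\<close>

section \<open>Linear algebra: independent systems can be solved for every right-hand side\<close>

text \<open>Each \<open>f i\<close> is read as a linear functional on vectors indexed by
  \<open>L\<close>. In the induction step, the new functional \<open>f p\<close> is no combination
  of the old ones, so some vector is killed by all old ones but not by \<open>f p\<close>. It serves
  \<open>p\<close> and corrects the earlier dual vectors.\<close>

lemma exists_dual_family:
  fixes f :: "'i \<Rightarrow> 'l \<Rightarrow> 'a :: field"
  assumes "finite I" "finite L"
    and "\<And>c. (\<forall>l\<in>L. (\<Sum>i\<in>I. c i * f i l) = 0) \<Longrightarrow> \<forall>i\<in>I. c i = 0"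
  shows "\<exists>x. \<forall>i\<in>I. \<forall>j\<in>I. (\<Sum>l\<in>L. f i l * x j l) = (if i = j then 1 else 0)"
  using assms(1,3)
proof (induction I rule: finite_induct)
  case empty
  then show ?case by simp
next
  case (insert p I)
  have indep: "\<forall>i\<in>I. c i = 0" if "\<forall>l\<in>L. (\<Sum>i\<in>I. c i * f i l) = 0" for c
  proof -
    have "(\<Sum>i\<in>I. (c(p := 0)) i * f i l) = (\<Sum>i\<in>I. c i * f i l)" for l
      using insert.hyps by (intro sum.cong) auto
    then have "\<forall>l\<in>L. (\<Sum>i\<in>insert p I. (c(p := 0)) i * f i l) = 0"
      using that insert.hyps by simp
    then have "\<forall>i\<in>insert p I. (c(p := 0)) i = 0" by (rule insert.prems[of "c(p := 0)"])
    then show ?thesis using insert.hyps by (metis fun_upd_other insertI2)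
  qed
  obtain x where x: "\<And>i j. i \<in> I \<Longrightarrow> j \<in> I \<Longrightarrow> (\<Sum>l\<in>L. f i l * x j l) = (if i = j then 1 else 0)"
    using insert.IH[OF indep] by auto
  \<comment> \<open>If \<open>f p\<close> were a combination of the old functionals, evaluation at
    the dual vectors \<open>x i\<close> would force exactly these coefficients. Independence makes
    that combination fail at some coordinate \<open>e\<close>.\<close>
  define a where "a i = (\<Sum>l\<in>L. f p l * x i l)" for i
  obtain e where e: "e \<in> L" "f p e - (\<Sum>i\<in>I. a i * f i e) \<noteq> 0"
  proof -
    define c where "c = (\<lambda>i. if i = p then 1 else - a i)"
    have "(\<Sum>i\<in>I. c i * f i l) = (\<Sum>i\<in>I. - (a i * f i l))" for l
      using insert.hyps by (intro sum.cong) (auto simp: c_def)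
    then have "(\<Sum>i\<in>insert p I. c i * f i l) = f p l - (\<Sum>i\<in>I. a i * f i l)" for l
      using insert.hyps by (simp add: c_def sum_negf)
    moreover have "\<not> (\<forall>i\<in>insert p I. c i = 0)" by (simp add: c_def)
    ultimately show ?thesis using insert.prems[of c] that by auto
  qed
  \<comment> \<open>Project the unit vector at \<open>e\<close> onto the common kernel of the old functionals and normalise.\<close>
  define g where "g = f p e - (\<Sum>i\<in>I. a i * f i e)"
  define z where "z l = ((if l = e then 1 else 0) - (\<Sum>i\<in>I. f i e * x i l)) / g" for l
  have z: "(\<Sum>l\<in>L. h l * z l) = (h e - (\<Sum>i\<in>I. f i e * (\<Sum>l\<in>L. h l * x i l))) / g" for h
  proof -
    have "(\<Sum>l\<in>L. h l * z l) = (\<Sum>l\<in>L. (if l = e then h l else 0) - (\<Sum>i\<in>I. f i e * (h l * x i l))) / g"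
      by (auto simp: z_def sum_divide_distrib algebra_simps sum_distrib_left intro!: sum.cong)
    also have "(\<Sum>l\<in>L. (if l = e then h l else 0) - (\<Sum>i\<in>I. f i e * (h l * x i l))) =
        h e - (\<Sum>i\<in>I. f i e * (\<Sum>l\<in>L. h l * x i l))"
      using e(1) assms(2) by (simp add: sum_subtractf sum_distrib_left sum.swap[of _ I L])
    finally show ?thesis .
  qed
  have z_old: "(\<Sum>l\<in>L. f i l * z l) = 0" if "i \<in> I" for i
  proof -
    have "(\<Sum>j\<in>I. f j e * (\<Sum>l\<in>L. f i l * x j l)) = (\<Sum>j\<in>I. if i = j then f j e else 0)"
      using that x by (intro sum.cong) auto
    then show ?thesis using that insert.hyps by (simp add: z)
  qed
  have z_new: "(\<Sum>l\<in>L. f p l * z l) = 1"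
    using e(2) by (simp add: z g_def flip: a_def) (simp add: mult.commute)
  \<comment> \<open>Subtracting \<open>a j * z\<close> makes \<open>f p\<close> vanish on the old
    dual vectors. The old functionals vanish on \<open>z\<close>, so their values do not
    change.\<close>
  define x' where "x' = (\<lambda>j l. if j = p then z l else x j l - a j * z l)"
  have x'_p: "x' p l = z l" for l by (simp add: x'_def)
  have x'_I: "x' j l = x j l - a j * z l" if "j \<in> I" for j l
    using that insert.hyps by (auto simp: x'_def)
  have expand: "(\<Sum>l\<in>L. f i l * (x j l - a j * z l)) = (\<Sum>l\<in>L. f i l * x j l) - a j * (\<Sum>l\<in>L. f i l * z l)" for i j
    by (simp add: algebra_simps sum_subtractf sum_distrib_left)
  have "\<forall>i\<in>insert p I. \<forall>j\<in>insert p I. (\<Sum>l\<in>L. f i l * x' j l) = (if i = j then 1 else 0)"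
    using insert.hyps by (auto simp: x'_p x'_I expand x z_old z_new simp flip: a_def)
  then show ?case by blast
qed

text \<open>Dual vectors combined with the prescribed values as coefficients solve the system. This
  yields the surjectivity of the map from \<open>(m, z)\<close> to the selected entries.\<close>

lemma exists_dual_value:
  fixes f :: "'i \<Rightarrow> 'l \<Rightarrow> 'a :: field"
  assumes "finite I" "finite L"
    and "\<And>c. (\<forall>l\<in>L. (\<Sum>i\<in>I. c i * f i l) = 0) \<Longrightarrow> \<forall>i\<in>I. c i = 0"
  shows "\<exists>x. \<forall>i\<in>I. (\<Sum>l\<in>L. f i l * x l) = y i"
proof -
  obtain x where x: "\<And>i j. i \<in> I \<Longrightarrow> j \<in> I \<Longrightarrow> (\<Sum>l\<in>L. f i l * x j l) = (if i = j then 1 else 0)"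
    using exists_dual_family[of I L f, OF assms(1,2) assms(3)] by auto
  have "(\<Sum>l\<in>L. f i l * (\<Sum>j\<in>I. y j * x j l)) = y i" if "i \<in> I" for i
  proof -
    have "(\<Sum>l\<in>L. f i l * (\<Sum>j\<in>I. y j * x j l)) = (\<Sum>j\<in>I. y j * (\<Sum>l\<in>L. f i l * x j l))"
      by (simp add: sum_distrib_left sum.swap[of _ I L] mult.left_commute)
    also have "\<dots> = (\<Sum>j\<in>I. if i = j then y j else 0)"
      using that x by (intro sum.cong) auto
    also have "\<dots> = y i" using that assms(1) by simp
    finally show ?thesis .
  qed
  then show ?thesis by (intro exI[of _ "\<lambda>l. \<Sum>j\<in>I. y j * x j l"]) simp
qed

lemma lin_indpt_family_coeffs_zero:
  fixes f :: "'i \<Rightarrow> 'a :: field vec"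
  assumes "lin_indpt_family k I f" "finite I"
    and f: "\<And>i. i \<in> I \<Longrightarrow> f i \<in> carrier_vec k"
    and zero: "\<forall>l<k. (\<Sum>i\<in>I. c i * f i $ l) = 0"
  shows "\<forall>i\<in>I. c i = 0"
proof (rule ccontr)
  assume "\<not> ?thesis"
  then obtain p where p: "p \<in> I" "c p \<noteq> 0" by blast
  interpret vec_space "TYPE('a)" k .
  have inj: "inj_on f I" and indep: "\<not> lin_dep (f ` I)"
    using assms(1) by (auto simp: lin_indpt_family_def)
  define b where "b v = c (inv_into I f v)" for v
  have sub: "f ` I \<subseteq> carrier_vec k" using f by auto
  have "lincomb b (f ` I) = 0\<^sub>v k"
  proof (rule eq_vecI)
    have "lincomb b (f ` I) \<in> carrier_vec k" using sub assms(2) by (intro lincomb_closed) auto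
    then show "dim_vec (lincomb b (f ` I)) = dim_vec (0\<^sub>v k)" by simp
    show "lincomb b (f ` I) $ l = 0\<^sub>v k $ l" if "l < dim_vec (0\<^sub>v k)" for l
      using that zero inj by (simp add: lincomb_index sub sum.reindex b_def)
  qed
  then have "lin_dep (f ` I)"
    using assms(2) p inj by (intro lin_dep_crit[where A = "f ` I" and a = b and v = "f p"]) (auto simp: b_def)
  with indep show False by simp
qed

section \<open>Counting: uniform fibres and inclusion-exclusion\<close>

text \<open>Exchanging \<open>y\<close> and \<open>y'\<close> turns the inequality into equality of
  all fibre sizes. With common size \<open>c\<close>, both sides are
  \<open>card B * card Y * c\<close>; the product form avoids division.\<close>

lemma card_mult_uniform_fibers:
  assumes "finite X" "h ` X \<subseteq> Y" "finite Y" "B \<subseteq> Y"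
    and fiber: "\<And>y y'. y \<in> Y \<Longrightarrow> y' \<in> Y \<Longrightarrow> card {x\<in>X. h x = y} \<le> card {x\<in>X. h x = y'}"
  shows "card {x\<in>X. h x \<in> B} * card Y = card B * card X"
proof (cases "Y = {}")
  case False
  then obtain y0 where y0: "y0 \<in> Y" by blast
  have fib: "card {x\<in>X. h x = y} = card {x\<in>X. h x = y0}" if "y \<in> Y" for y
    using fiber that y0 by (simp add: order_antisym)
  have count: "card {x\<in>X. h x \<in> S} = card S * card {x\<in>X. h x = y0}" if "S \<subseteq> Y" for S
  proof -
    have "card {x\<in>X. h x \<in> S} = (\<Sum>y\<in>S. card {x \<in> {x\<in>X. h x \<in> S}. h x = y})"
      using sum.group[of "{x\<in>X. h x \<in> S}" S h "\<lambda>_. 1 :: nat"] assms(1) finite_subset[OF that assms(3)]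
      by (simp add: image_subset_iff)
    also have "\<dots> = (\<Sum>y\<in>S. card {x\<in>X. h x = y0})"
    proof (rule sum.cong[OF refl])
      fix y assume "y \<in> S"
      moreover from this have "{x \<in> {x\<in>X. h x \<in> S}. h x = y} = {x\<in>X. h x = y}" by auto
      ultimately show "card {x \<in> {x\<in>X. h x \<in> S}. h x = y} = card {x\<in>X. h x = y0}"
        using fib that by auto
    qed
    finally show ?thesis by simp
  qed
  have "{x\<in>X. h x \<in> Y} = X" using assms(2) by auto
  then show ?thesis using count[of B] count[of Y] assms(4) by simp
qed (use assms in auto)

text \<open>The functions missing some value are the union over \<open>a\<close> of those that avoid
  \<open>a\<close>. Those avoiding all of a nonempty \<open>B\<close> number
  \<open>(card A - card B) ^ card I\<close>, so inclusion-exclusion grouped by \<open>card B\<close>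
  gives the binomial sum.\<close>

lemma card_not_surj_funcset:
  assumes "finite I" "finite A"
  shows "real (card {y \<in> I \<rightarrow>\<^sub>E A. y ` I \<noteq> A}) =
    (\<Sum>i=1..card A. (-1) ^ (i + 1) * real (card A choose i) * real (card A - i) ^ card I)"
proof -
  define M where "M a = I \<rightarrow>\<^sub>E (A - {a})" for a
  interpret Incl_Excl finite "real \<circ> card"
  proof qed (auto simp: card_Un_disjnt)
  have union: "{y \<in> I \<rightarrow>\<^sub>E A. y ` I \<noteq> A} = \<Union> (M ` A)"
    by (auto simp: M_def PiE_iff image_iff) metis
  have inter: "\<Inter> (M ` B) = I \<rightarrow>\<^sub>E (A - B)" if "B \<noteq> {}" for B
    using that by (auto simp: M_def PiE_iff)
  have finB: "finite B" if "B \<subseteq> A" for B using that assms(2) finite_subset by blast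
  have "real (card (\<Union> (M ` A))) =
      (\<Sum>B | B \<subseteq> A \<and> B \<noteq> {}. (-1) ^ (card B + 1) * real (card (\<Inter> (M ` B))))"
    using restricted_indexed[of A M] assms by (simp add: M_def finite_PiE)
  also have "\<dots> = (\<Sum>B | B \<subseteq> A \<and> B \<noteq> {}. (-1) ^ (card B + 1) * real (card A - card B) ^ card I)"
    using assms(1) finB by (intro sum.cong) (auto simp: inter card_funcsetE card_Diff_subset)
  also have "\<dots> = (\<Sum>i=1..card A. \<Sum>B | B \<in> {B. B \<subseteq> A \<and> B \<noteq> {}} \<and> card B = i.
      (-1) ^ (card B + 1) * real (card A - card B) ^ card I)"
    using assms(2) finB
    by (intro sum.group[symmetric]) (auto simp: Suc_le_eq card_gt_0_iff card_mono)
  also have "\<dots> = (\<Sum>i=1..card A. (-1) ^ (i + 1) * real (card A choose i) * real (card A - i) ^ card I)"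
  proof (rule sum.cong[OF refl])
    fix i assume "i \<in> {1..card A}"
    then have "{B. B \<in> {B. B \<subseteq> A \<and> B \<noteq> {}} \<and> card B = i} = {B. B \<subseteq> A \<and> card B = i}" by auto
    then show "(\<Sum>B | B \<in> {B. B \<subseteq> A \<and> B \<noteq> {}} \<and> card B = i.
        (-1) ^ (card B + 1) * real (card A - card B) ^ card I) =
      (-1) ^ (i + 1) * real (card A choose i) * real (card A - i) ^ card I"
      using n_subsets[OF assms(2), of i] by simp
  qed
  finally show ?thesis by (simp add: union)
qed

section \<open>The masking probability\<close>

theorem theorem3:
  fixes G G1 G0 P :: "'a :: {field, finite} mat"
    and C :: "'a vec set"
    and \<phi> :: "nat \<Rightarrow> nat"
    and q n t r k1 k u d :: nat
  assumes "q = CARD('a)"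
    and "int k1 = int n - 1 - int r"
    and "k = k1 + 1"
    and "q \<le> u" and "u \<le> k1"
    and "P \<in> carrier_mat k1 r"
    and "G1 = 0\<^sub>m k1 1 @\<^sub>c 1\<^sub>m k1 @\<^sub>c P"
    and "G0 = ones_mat 1 1 @\<^sub>c ones_mat 1 k1 @\<^sub>c ones_mat 1 r"
    and "G = G1 @\<^sub>r G0"
    and "linear_code n k d C"
    and "generator_matrix n k C G"
    and "d \<ge> 2 * t + 1"
    and "\<forall>i\<in>{1..u}. \<phi> i < n"
    and "inj_on \<phi> {1..u}"
    and "lin_indpt_family k {1..u} (\<lambda>i. col G (\<phi> i))"
  shows "measure_pmf.prob (pmf_of_set (carrier_vec k1)) {m. maskable G1 G0 (\<phi> ` {1..u}) m} =
    (\<Sum>i=1..q. (-1) ^ (i + 1) * real (q choose i) * real (q - i) ^ u) / real q ^ u"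
proof -
  define I where "I = {1..u}"
  have I: "finite I" "card I = u" by (simp_all add: I_def)
  have n: "n = 1 + (k1 + r)" using assms(2) by linarith
  have G1: "G1 \<in> carrier_mat k1 n" and G0: "G0 \<in> carrier_mat 1 n"
    using assms(6-8) by (auto simp: n append_cols_def ones_mat_def)
  have ones: "G0 $$ (0, j) = 1" if "j < n" for j
    using that by (auto simp: assms(8) n append_cols_def ones_mat_def)
  have Gc: "G \<in> carrier_mat k n"
    using G1 G0 by (auto simp: assms(3,9) append_rows_def)
  have G_upper: "G $$ (l, j) = G1 $$ (l, j)" if "l < k1" "j < n" for l j
    using that G1 G0 by (auto simp: assms(9) append_rows_def)
  have G_last: "G $$ (k1, j) = 1" if "j < n" for j
    using that G1 G0 by (auto simp: assms(9) append_rows_def ones)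
  have \<phi>: "\<phi> i < n" if "i \<in> I" for i using that assms(13) by (simp add: I_def)

  \<comment> \<open>For \<open>j < n\<close>, \<open>w m j\<close> is entry \<open>j\<close> of
    \<open>m G1\<close>, and \<open>h (m, z)\<close> lists the entries of \<open>m G1 + z G0\<close>
    at the stuck cells. \<open>B\<close> holds the tuples that miss some field element.\<close>
  define w where "w m j = (\<Sum>l<k1. G1 $$ (l, j) * m $ l)" for m :: "'a vec" and j
  define h where "h = (\<lambda>(m, z). \<lambda>i\<in>I. w m (\<phi> i) + z)"
  define X where "X = (carrier_vec k1 :: 'a vec set) \<times> (UNIV :: 'a set)"
  define Y where "Y = I \<rightarrow>\<^sub>E (UNIV :: 'a set)"
  define B where "B = {y \<in> Y. y ` I \<noteq> UNIV}"

  have surj: "\<exists>m\<in>carrier_vec k1. \<exists>z. \<forall>i\<in>I. w m (\<phi> i) + z = y i" for y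
  proof -
    have "\<exists>x. \<forall>i\<in>I. (\<Sum>l\<in>{..<k}. col G (\<phi> i) $ l * x l) = y i"
    proof (rule exists_dual_value)
      fix c assume "\<forall>l\<in>{..<k}. (\<Sum>i\<in>I. c i * col G (\<phi> i) $ l) = 0"
      then show "\<forall>i\<in>I. c i = 0"
        using assms(15) Gc I
        by (intro lin_indpt_family_coeffs_zero[of k I "\<lambda>i. col G (\<phi> i)"]) (auto simp: I_def)
    qed (use I in auto)
    then obtain x where x: "\<And>i. i \<in> I \<Longrightarrow> (\<Sum>l<k. col G (\<phi> i) $ l * x l) = y i" by blast
    have "w (vec k1 x) (\<phi> i) + x k1 = y i" if "i \<in> I" for i
    proof -
      have "(\<Sum>l<k. col G (\<phi> i) $ l * x l) = (\<Sum>l<k. G $$ (l, \<phi> i) * x l)"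
        using Gc \<phi>[OF that] by (intro sum.cong) auto
      also have "\<dots> = (\<Sum>l<k1. G1 $$ (l, \<phi> i) * x l) + x k1"
        using \<phi>[OF that] by (simp add: assms(3) G_upper G_last)
      finally show ?thesis using x[OF that] by (simp add: w_def)
    qed
    \<comment> \<open>The first \<open>k1\<close> coordinates of the solution form the message; the
      last one belongs to the all-one row and supplies \<open>z\<close>.\<close>
    then show ?thesis by (intro bexI[of _ "vec k1 x"] exI[of _ "x k1"]) auto
  qed

  have w_add: "w (m + s) j = w m j + w s j" if "m \<in> carrier_vec k1" "s \<in> carrier_vec k1" for m s j
    using that by (simp add: w_def distrib_left sum.distrib)
  \<comment> \<open>Translation by a preimage \<open>(s, \<zeta>)\<close> of \<open>y' - y\<close>
    maps the fibre over \<open>y\<close> injectively into the fibre over \<open>y'\<close>.\<close>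
  have fiber: "card {p\<in>X. h p = y} \<le> card {p\<in>X. h p = y'}" if y: "y \<in> Y" "y' \<in> Y" for y y'
  proof -
    obtain s \<zeta> where s: "s \<in> carrier_vec k1" "\<And>i. i \<in> I \<Longrightarrow> w s (\<phi> i) + \<zeta> = y' i - y i"
      using surj[of "\<lambda>i. y' i - y i"] by blast
    have cancel: "m + s - s = m" if "m \<in> carrier_vec k1" for m
      using that s(1) by (intro eq_vecI) auto
    show ?thesis
    proof (rule card_inj_on_le)
      show "inj_on (\<lambda>(m, z). (m + s, z + \<zeta>)) {p\<in>X. h p = y}"
        using s(1) by (auto simp: inj_on_def X_def) (metis cancel)
      show "(\<lambda>(m, z). (m + s, z + \<zeta>)) ` {p\<in>X. h p = y} \<subseteq> {p\<in>X. h p = y'}"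
      proof clarsimp
        fix m z assume mz: "(m, z) \<in> X" "y = h (m, z)"
        then have m: "m \<in> carrier_vec k1" by (simp add: X_def)
        have "h (m + s, z + \<zeta>) i = y' i" for i
        proof (cases "i \<in> I")
          case True
          then show ?thesis using s(2)[OF True] mz(2) m s(1) by (simp add: h_def w_add algebra_simps)
        next
          case False
          then show ?thesis using y(2) by (auto simp: h_def Y_def PiE_def extensional_def)
        qed
        then show "(m + s, z + \<zeta>) \<in> X \<and> h (m + s, z + \<zeta>) = y'"
          using m s(1) by (auto simp: X_def)
      qed
      show "finite {p\<in>X. h p = y'}" by (simp add: X_def)
    qed
  qed

  \<comment> \<open>This holds for every \<open>z\<close>: the shift \<open>z0\<close> avoids zero
    exactly if the word shifted by \<open>z\<close> avoids the value
    \<open>v = z - z0\<close>.\<close>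
  have mask: "maskable G1 G0 (\<phi> ` {1..u}) m \<longleftrightarrow> h (m, z) \<in> B" if m: "m \<in> carrier_vec k1" for m z
  proof -
    have "(mat_of_row m * G1 + z0 \<cdot>\<^sub>m G0) $$ (0, \<phi> i) = w m (\<phi> i) + z0" if "i \<in> I" for z0 i
      using m G1 G0 \<phi>[OF that]
      by (simp add: ones w_def scalar_prod_def atLeast0LessThan mult.commute)
    then have "maskable G1 G0 (\<phi> ` {1..u}) m \<longleftrightarrow> (\<exists>z0. \<forall>i\<in>I. w m (\<phi> i) + z0 \<noteq> 0)"
      by (auto simp: maskable_def I_def)
    also have "\<dots> \<longleftrightarrow> (\<exists>v. \<forall>i\<in>I. w m (\<phi> i) + z \<noteq> v)"
    proof
      assume "\<exists>z0. \<forall>i\<in>I. w m (\<phi> i) + z0 \<noteq> 0"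
      then obtain z0 where "\<forall>i\<in>I. w m (\<phi> i) + z0 \<noteq> 0" ..
      then show "\<exists>v. \<forall>i\<in>I. w m (\<phi> i) + z \<noteq> v"
        by (intro exI[of _ "z - z0"]) (auto simp: algebra_simps)
    next
      assume "\<exists>v. \<forall>i\<in>I. w m (\<phi> i) + z \<noteq> v"
      then obtain v where "\<forall>i\<in>I. w m (\<phi> i) + z \<noteq> v" ..
      then show "\<exists>z0. \<forall>i\<in>I. w m (\<phi> i) + z0 \<noteq> 0"
        by (intro exI[of _ "z - v"]) (auto simp: algebra_simps)
    qed
    also have "\<dots> \<longleftrightarrow> (\<exists>v. v \<notin> h (m, z) ` I)"
      by (intro ex_cong1) (auto simp: h_def)
    also have "\<dots> \<longleftrightarrow> h (m, z) ` I \<noteq> UNIV" by blast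
    finally show ?thesis by (auto simp: B_def Y_def h_def)
  qed

  define M where "M = {m \<in> carrier_vec k1. maskable G1 G0 (\<phi> ` {1..u}) m}"
  \<comment> \<open>As masking does not depend on \<open>z\<close>, each maskable message occurs
    with all \<open>q\<close> values of \<open>z\<close>; this factor cancels against the one in
    \<open>card X\<close>.\<close>
  have "{p\<in>X. h p \<in> B} = M \<times> UNIV"
    using mask by (auto simp: X_def M_def)
  moreover have "card {p\<in>X. h p \<in> B} * card Y = card B * card X"
    using I fiber by (intro card_mult_uniform_fibers) (auto simp: X_def Y_def B_def h_def finite_PiE)
  ultimately have "card M * q * q ^ u = card B * (q ^ k1 * q)"
    using I by (simp add: X_def Y_def card_cartesian_product card_carrier_vec card_funcsetE assms(1))
  moreover have q: "q > 0" by (simp add: assms(1) card_gt_0_iff)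
  ultimately have "card M * q ^ u = card B * q ^ k1" by simp
  then have "real (card M) * real q ^ u = real (card B) * real q ^ k1"
    by (metis of_nat_mult of_nat_power)
  then have "real (card M) / real q ^ k1 = real (card B) / real q ^ u"
    using q by (simp add: field_simps)
  moreover have "measure_pmf.prob (pmf_of_set (carrier_vec k1)) {m. maskable G1 G0 (\<phi> ` {1..u}) m} =
      real (card M) / real q ^ k1"
  proof -
    have "carrier_vec k1 \<noteq> ({} :: 'a vec set)" using zero_carrier_vec by blast
    moreover have "carrier_vec k1 \<inter> {m. maskable G1 G0 (\<phi> ` {1..u}) m} = M" by (auto simp: M_def)
    ultimately show ?thesis
      by (simp add: measure_pmf_of_set card_carrier_vec assms(1))
  qed
  moreover have "real (card B) = (\<Sum>i=1..q. (-1) ^ (i + 1) * real (q choose i) * real (q - i) ^ u)"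
    using card_not_surj_funcset[of I "UNIV :: 'a set"] I by (simp add: B_def Y_def assms(1))
  ultimately show ?thesis by simp
qed

end
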